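(* The following three $\mathbb{S}$-collections, equipped with the compositions $\{\circ_i^c\}$, are suboperads of $(\mathsf{scpx},\{\circ_i^c\})$ and of $(\mathsf{scpx}_{\neq\emptyset},\{\circ_i^c\})$: (1) $\mathcal{T}_n=\{\{\emptyset\}\}$, $n\ge1$, whose only operation of arity $n$ is the complex $\{\emptyset\}$ on $[n]$ (unital); (2) $\mathcal{S}_n=\{\Delta_{[n]}\}$, $n\ge1$ (non-unital); (3) $\partial\mathcal{S}_n=\{\partial\Delta_{[n]}\}$, $n\ge1$ (unital). Furthermore, these operads are isomorphic to $\mathit{Com}$.
   Context: For $n\ge1$ let $[n]=\{1,\dots,n\}$. $\mathsf{scpx}(n)$ is the set of families of subsets of $[n]$ closed under taking subsets (simplicial complexes on $[n]$, the empty family being allowed), and $\mathsf{scpx}_{\neq\emptyset}(n)$ the subset of those different from the empty family; $\mathbb{S}_n$ acts by relabelling. $\Delta_{[n]}$ is the complex of all subsets of $[n]$, and $\partial\Delta_{[n]}$ the complex of all proper subsets of $[n]$ (its facets are the subsets of size $n-1$). For $I\subseteq[n]$, $J\subseteq[m]$, $k\in[n]$, with $I^{<k}=\{i\in I\mid i<k\}$, $I^{>k}=\{i\in I\mid i>k\}$, $I+\ell=\{i+\ell\mid i\in I\}$, put $I\circ_k^cJ=I^{<k}\sqcup([m]+k-1)\sqcup(I^{>k}+m-1)$ if $k\in I$ and $I\circ_k^cJ=I^{<k}\sqcup(J+k-1)\sqcup(I^{>k}+m-1)$ if $k\notin I$. In the composition operad, $K\circ_k^cL$ is the set of all subsets of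 the sets $I\circ_k^cJ$ with $I\in K$, $J\in L$, and the unit is $\{\emptyset\}$ on $[1]$. $\mathit{Com}$ is the commutative set operad with exactly one operation in each arity $n\ge1$ (trivial $\mathbb{S}_n$-action) and none in arity $0$. "Unital" means the suboperad contains the unit of the ambient operad; in the non-unital case, suboperad and isomorphism are meant in the category of non-unital operads. *)

theory Defs
  imports "HOL-Combinatorics.Permutations"
begin

section \<open>Symmetric set operads, in terms of partial compositions\<close>

text \<open>
  The same object may be an operation in several arities (for instance, the complex
  \<open>{\<emptyset>}\<close> on \<open>[n]\<close> is an operation of every arity \<open>n \<ge> 1\<close>), so the structure maps take the
  arities as arguments: \<open>pcomp P n m k \<mu> \<nu>\<close> is \<open>\<mu> \<circ>\<^sub>k \<nu>\<close> for \<open>\<mu>\<close> of arity \<open>n\<close> and \<open>\<nu>\<close> of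
  arity \<open>m\<close>, and \<open>act P n \<sigma> \<mu>\<close> is the action on arity \<open>n\<close> of a permutation \<open>\<sigma>\<close> of \<open>{1..n}\<close>.

  The symmetric groups act on the left, \<open>\<sigma> \<cdot> \<mu>\<close> being \<open>\<mu>\<close> with input \<open>i\<close> renamed \<open>\<sigma> i\<close>.
  The corresponding right action is \<open>\<mu> \<cdot> \<sigma> = \<sigma>\<^sup>-\<^sup>1 \<cdot> \<mu>\<close>.
\<close>

record 'a nonunital_opd =
  ops :: "nat \<Rightarrow> 'a set"
  act :: "nat \<Rightarrow> (nat \<Rightarrow> nat) \<Rightarrow> 'a \<Rightarrow> 'a"
  pcomp :: "nat \<Rightarrow> nat \<Rightarrow> nat \<Rightarrow> 'a \<Rightarrow> 'a \<Rightarrow> 'a"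

record 'a opd = "'a nonunital_opd" +
  opunit :: "'a"

text \<open>
  The partial composition \<open>\<sigma> \<circ>\<^sub>k \<tau>\<close> of permutations \<open>\<sigma>\<close> of \<open>{1..n}\<close> and \<open>\<tau>\<close> of \<open>{1..m}\<close>, a
  permutation of \<open>{1..n+m-1}\<close>: the inputs \<open>k, \<dots>, k+m-1\<close> form a block that is permuted by
  \<open>\<tau>\<close> and moved to position \<open>\<sigma> k\<close>, the other inputs are permuted by \<open>\<sigma>\<close>.
\<close>

definition perm_pcomp :: "nat \<Rightarrow> nat \<Rightarrow> (nat \<Rightarrow> nat) \<Rightarrow> (nat \<Rightarrow> nat) \<Rightarrow> nat \<Rightarrow> nat" where
  "perm_pcomp m k \<sigma> \<tau> p =
     (if k \<le> p \<and> p < k + m then \<tau> (p + 1 - k) + \<sigma> k - 1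
      else let a = (if p < k then p else p + 1 - m)
           in if \<sigma> a < \<sigma> k then \<sigma> a else \<sigma> a + m - 1)"

locale nonunital_operad =
  fixes P :: "('a, 'b) nonunital_opd_scheme"
  assumes act_closed:
      "\<lbrakk>\<sigma> permutes {1..n}; \<mu> \<in> ops P n\<rbrakk> \<Longrightarrow> act P n \<sigma> \<mu> \<in> ops P n"
    and act_id: "\<mu> \<in> ops P n \<Longrightarrow> act P n id \<mu> = \<mu>"
    and act_comp:
      "\<lbrakk>\<sigma> permutes {1..n}; \<tau> permutes {1..n}; \<mu> \<in> ops P n\<rbrakk>
        \<Longrightarrow> act P n (\<sigma> \<circ> \<tau>) \<mu> = act P n \<sigma> (act P n \<tau> \<mu>)"
    and pcomp_closed:
      "\<lbrakk>\<mu> \<in> ops P n; \<nu> \<in> ops P m; k \<in> {1..n}\<rbrakk> \<Longrightarrow> pcomp P n m k \<mu> \<nu> \<in> ops P (n + m - 1)"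
    and sequential_assoc:
      "\<lbrakk>\<kappa> \<in> ops P l; \<mu> \<in> ops P m; \<nu> \<in> ops P n; i \<in> {1..l}; j \<in> {1..m}\<rbrakk>
        \<Longrightarrow> pcomp P (l + m - 1) n (i + j - 1) (pcomp P l m i \<kappa> \<mu>) \<nu>
            = pcomp P l (m + n - 1) i \<kappa> (pcomp P m n j \<mu> \<nu>)"
    and parallel_assoc:
      "\<lbrakk>\<kappa> \<in> ops P l; \<mu> \<in> ops P m; \<nu> \<in> ops P n; i \<in> {1..l}; j \<in> {1..l}; i < j\<rbrakk>
        \<Longrightarrow> pcomp P (l + m - 1) n (j + m - 1) (pcomp P l m i \<kappa> \<mu>) \<nu>
            = pcomp P (l + n - 1) m i (pcomp P l n j \<kappa> \<nu>) \<mu>"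
    and equivariance:
      "\<lbrakk>\<mu> \<in> ops P n; \<nu> \<in> ops P m; k \<in> {1..n}; \<sigma> permutes {1..n}; \<tau> permutes {1..m}\<rbrakk>
        \<Longrightarrow> pcomp P n m (\<sigma> k) (act P n \<sigma> \<mu>) (act P m \<tau> \<nu>)
            = act P (n + m - 1) (perm_pcomp m k \<sigma> \<tau>) (pcomp P n m k \<mu> \<nu>)"

locale operad = nonunital_operad P
  for P :: "('a, 'b) opd_scheme" +
  assumes unit_closed: "opunit P \<in> ops P 1"
    and left_unit: "\<nu> \<in> ops P m \<Longrightarrow> pcomp P 1 m 1 (opunit P) \<nu> = \<nu>"
    and right_unit: "\<lbrakk>\<mu> \<in> ops P n; k \<in> {1..n}\<rbrakk> \<Longrightarrow> pcomp P n 1 k \<mu> (opunit P) = \<mu>"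

text \<open>
  A suboperad is given by its operations \<open>Q n\<close>; as an operad in its own right, it is
  \<open>P\<lparr>ops := Q\<rparr>\<close>.
\<close>

locale nonunital_suboperad = nonunital_operad P
  for Q :: "nat \<Rightarrow> 'a set" and P :: "('a, 'b) nonunital_opd_scheme" +
  assumes sub_ops: "Q n \<subseteq> ops P n"
    and sub_act_closed: "\<lbrakk>\<sigma> permutes {1..n}; \<mu> \<in> Q n\<rbrakk> \<Longrightarrow> act P n \<sigma> \<mu> \<in> Q n"
    and sub_pcomp_closed:
      "\<lbrakk>\<mu> \<in> Q n; \<nu> \<in> Q m; k \<in> {1..n}\<rbrakk> \<Longrightarrow> pcomp P n m k \<mu> \<nu> \<in> Q (n + m - 1)"

locale suboperad = operad P + nonunital_suboperad Q P
  for Q :: "nat \<Rightarrow> 'a set" and P :: "('a, 'b) opd_scheme" +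
  assumes sub_unit: "opunit P \<in> Q 1"

definition nonunital_operad_iso ::
    "('a, 'c) nonunital_opd_scheme \<Rightarrow> ('b, 'd) nonunital_opd_scheme
      \<Rightarrow> (nat \<Rightarrow> 'a \<Rightarrow> 'b) \<Rightarrow> bool" where
  "nonunital_operad_iso P Q f \<longleftrightarrow>
     nonunital_operad P \<and> nonunital_operad Q \<and>
     (\<forall>n. bij_betw (f n) (ops P n) (ops Q n)) \<and>
     (\<forall>n \<sigma>. \<forall>\<mu>\<in>ops P n. \<sigma> permutes {1..n} \<longrightarrow> f n (act P n \<sigma> \<mu>) = act Q n \<sigma> (f n \<mu>)) \<and>
     (\<forall>n m. \<forall>\<mu>\<in>ops P n. \<forall>\<nu>\<in>ops P m. \<forall>k\<in>{1..n}.
        f (n + m - 1) (pcomp P n m k \<mu> \<nu>) = pcomp Q n m k (f n \<mu>) (f m \<nu>))"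

definition operad_iso ::
    "('a, 'c) opd_scheme \<Rightarrow> ('b, 'd) opd_scheme \<Rightarrow> (nat \<Rightarrow> 'a \<Rightarrow> 'b) \<Rightarrow> bool" where
  "operad_iso P Q f \<longleftrightarrow>
     operad P \<and> operad Q \<and> nonunital_operad_iso P Q f \<and> f 1 (opunit P) = opunit Q"

definition nonunital_isomorphic ::
    "('a, 'c) nonunital_opd_scheme \<Rightarrow> ('b, 'd) nonunital_opd_scheme \<Rightarrow> bool" where
  "nonunital_isomorphic P Q \<longleftrightarrow> (\<exists>f. nonunital_operad_iso P Q f)"

definition isomorphic :: "('a, 'c) opd_scheme \<Rightarrow> ('b, 'd) opd_scheme \<Rightarrow> bool" where
  "isomorphic P Q \<longleftrightarrow> (\<exists>f. operad_iso P Q f)"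

definition Com :: "unit opd" where
  "Com = \<lparr>ops = (\<lambda>n. if n \<ge> 1 then {()} else {}), act = (\<lambda>n \<sigma> \<mu>. \<mu>),
          pcomp = (\<lambda>n m k \<mu> \<nu>. ()), opunit = ()\<rparr>"


section \<open>The composition operad on simplicial complexes\<close>

definition scpx :: "nat \<Rightarrow> nat set set set" where
  "scpx n = (if n \<ge> 1 then {K. K \<subseteq> Pow {1..n} \<and> (\<forall>I\<in>K. \<forall>J. J \<subseteq> I \<longrightarrow> J \<in> K)} else {})"

definition scpx_ne :: "nat \<Rightarrow> nat set set set" where
  "scpx_ne n = scpx n - {{}}"

definition relabel :: "(nat \<Rightarrow> nat) \<Rightarrow> nat set set \<Rightarrow> nat set set" where
  "relabel \<sigma> K = (\<lambda>I. \<sigma> ` I) ` K"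

text \<open>\<open>I \<circ>\<^sub>k\<^sup>c J\<close> for \<open>J \<subseteq> {1..m}\<close>. The subtractions do not truncate, as \<open>k \<ge> 1\<close>.\<close>

definition set_comp :: "nat \<Rightarrow> nat \<Rightarrow> nat set \<Rightarrow> nat set \<Rightarrow> nat set" where
  "set_comp m k I J =
     {i \<in> I. i < k}
     \<union> (\<lambda>j. j + k - 1) ` (if k \<in> I then {1..m} else J)
     \<union> (\<lambda>i. i + m - 1) ` {i \<in> I. i > k}"

definition cpx_comp :: "nat \<Rightarrow> nat \<Rightarrow> nat set set \<Rightarrow> nat set set \<Rightarrow> nat set set" where
  "cpx_comp m k K L = {A. \<exists>I\<in>K. \<exists>J\<in>L. A \<subseteq> set_comp m k I J}"

definition scpx_operad :: "nat set set opd" where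
  "scpx_operad = \<lparr>ops = scpx, act = (\<lambda>n. relabel), pcomp = (\<lambda>n. cpx_comp), opunit = {{}}\<rparr>"

definition scpx_ne_operad :: "nat set set opd" where
  "scpx_ne_operad = scpx_operad\<lparr>ops := scpx_ne\<rparr>"

definition full_simplex :: "nat \<Rightarrow> nat set set" where
  "full_simplex n = Pow {1..n}"

definition boundary_simplex :: "nat \<Rightarrow> nat set set" where
  "boundary_simplex n = {I. I \<subset> {1..n}}"

definition trivial_coll :: "nat \<Rightarrow> nat set set set" where
  "trivial_coll n = (if n \<ge> 1 then {{{}}} else {})"

definition simplex_coll :: "nat \<Rightarrow> nat set set set" where
  "simplex_coll n = (if n \<ge> 1 then {full_simplex n} else {})"

definition boundary_coll :: "nat \<Rightarrow> nat set set set" where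
  "boundary_coll n = (if n \<ge> 1 then {boundary_simplex n} else {})"

end

theory Submission
  imports Defs
begin

text \<open>
  Whether a position \<open>x\<close> lies in \<open>I \<circ>\<^sub>k\<^sup>c J\<close> depends only on where \<open>x\<close> comes from: let \<open>c\<close> collapse
  the block \<open>{k..<k+m}\<close> onto \<open>k\<close>; then \<open>x\<close> is a member iff \<open>c x \<in> I\<close>, or \<open>x\<close> is in the block and
  its place in the block belongs to \<open>J\<close> (\<open>mem_set_comp\<close>). Iterating this description shows that
  both bracketings of a threefold composition of sets consist of the same positions, and it shows
  that the composition of sets is monotone in both arguments. Monotonicity is what transfers
  associativity from sets to complexes: a proper subset of \<open>I \<circ>\<^sub>k\<^sup>c J\<close> is also a member of \<open>K \<circ>\<^sub>k\<^sup>c L\<close>,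
  but what it contributes to a further composite is contained in what \<open>I \<circ>\<^sub>k\<^sup>c J\<close> contributes.
  Equivariance holds because an image distributes over the union that defines \<open>I \<circ>\<^sub>k\<^sup>c J\<close>. Hence
  complexes form an operad, and the nonempty ones a suboperad, since a composite of nonempty
  families contains the empty set.

  The three collections are closed under composition for the following reasons. A composite of
  empty sets is empty. The full set composed with anything is full. A composite misses a position
  \<open>p\<close> in its range exactly if \<open>c p \<notin> I\<close> and, for \<open>p\<close> in the block, the place of \<open>p\<close> is not in \<open>J\<close>; so
  a composite of proper subsets is proper, and the complement of any single \<open>p\<close> contains every
  set missing \<open>p\<close> and is itself contained in a composite of proper subsets.

  Finally, nothing about complexes enters the comparison with \<open>Com\<close>: in an operad with a single
  operation in each positive arity and none in arity \<open>0\<close>, every equation between operations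
  of one arity holds automatically, so the only possible map to \<open>Com\<close> is an isomorphism.
\<close>

section \<open>Suboperads as operads\<close>

lemma (in nonunital_suboperad) nonunital_operad_restrict: "nonunital_operad (P\<lparr>ops := Q\<rparr>)"
proof -
  have in_P: "\<mu> \<in> Q n \<Longrightarrow> \<mu> \<in> ops P n" for \<mu> n
    using sub_ops by blast
  show ?thesis
    by unfold_locales
      (simp_all add: in_P sub_act_closed sub_pcomp_closed act_id act_comp sequential_assoc
        parallel_assoc equivariance del: One_nat_def)
qed

lemma (in suboperad) operad_restrict: "operad (P\<lparr>ops := Q\<rparr>)"
proof -
  interpret R: nonunital_operad "P\<lparr>ops := Q\<rparr>"
    by (rule nonunital_operad_restrict)
  have in_P: "\<mu> \<in> Q n \<Longrightarrow> \<mu> \<in> ops P n" for \<mu> n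
    using sub_ops by blast
  show ?thesis
    by unfold_locales (simp_all add: in_P sub_unit left_unit right_unit del: One_nat_def)
qed

text \<open>
  With these two lemmas, closure of a collection of nonempty complexes has to be checked only once,
  in the operad of all complexes.
\<close>

lemma nonunital_suboperad_restrict:
  assumes "nonunital_suboperad Q P" "nonunital_suboperad R P" "\<And>n. Q n \<subseteq> R n"
  shows "nonunital_suboperad Q (P\<lparr>ops := R\<rparr>)"
proof -
  interpret Q: nonunital_suboperad Q P by fact
  interpret R: nonunital_suboperad R P by fact
  interpret PR: nonunital_operad "P\<lparr>ops := R\<rparr>" by (rule R.nonunital_operad_restrict)
  show ?thesis
    by unfold_locales (use assms(3) in \<open>simp_all add: Q.sub_act_closed Q.sub_pcomp_closed del: One_nat_def\<close>)
qed

lemma suboperad_restrict: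
  assumes "suboperad Q P" "suboperad R P" "\<And>n. Q n \<subseteq> R n"
  shows "suboperad Q (P\<lparr>ops := R\<rparr>)"
proof -
  interpret Q: suboperad Q P by fact
  interpret R: suboperad R P by fact
  interpret PR: operad "P\<lparr>ops := R\<rparr>" by (rule R.operad_restrict)
  interpret PQ: nonunital_suboperad Q "P\<lparr>ops := R\<rparr>"
    by (intro nonunital_suboperad_restrict Q.nonunital_suboperad_axioms
        R.nonunital_suboperad_axioms assms(3))
  show ?thesis
    by unfold_locales (use Q.sub_unit in simp)
qed

section \<open>Operads with one operation in each positive arity\<close>

lemma operad_Com: "operad Com"
  by unfold_locales (auto simp: Com_def split: if_splits)

lemma nonunital_operad_iso_Com:
  assumes "nonunital_operad P" "\<And>n. ops P n = (if n \<ge> 1 then {x n} else {})"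
  shows "nonunital_operad_iso P Com (\<lambda>n \<mu>. ())"
  using assms operad_Com
  by (auto simp: nonunital_operad_iso_def operad_def Com_def bij_betw_def)

lemma nonunital_isomorphic_Com:
  assumes "nonunital_operad P" "\<And>n. ops P n = (if n \<ge> 1 then {x n} else {})"
  shows "nonunital_isomorphic P Com"
  using nonunital_operad_iso_Com[OF assms] by (auto simp: nonunital_isomorphic_def)

lemma isomorphic_Com:
  assumes "operad P" "\<And>n. ops P n = (if n \<ge> 1 then {x n} else {})"
  shows "isomorphic P Com"
  using nonunital_operad_iso_Com[OF operad.axioms(1)[OF assms(1)] assms(2)] assms(1) operad_Com
  by (auto simp: isomorphic_def operad_iso_def)

section \<open>Composition of subsets\<close>

definition collapse :: "nat \<Rightarrow> nat \<Rightarrow> nat \<Rightarrow> nat" where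
  "collapse m k x = (if x < k then x else if x < k + m then k else x + 1 - m)"

text \<open>
  The disjunction absorbs the case distinction in the definition of \<open>I \<circ>\<^sub>k\<^sup>c J\<close>: the block collapses
  to \<open>k\<close>, so if \<open>k \<in> I\<close> the first disjunct already admits all of it.
\<close>

lemma mem_set_comp:
  assumes "J \<subseteq> {1..m}" "k \<ge> 1" "m \<ge> 1"
  shows "x \<in> set_comp m k I J \<longleftrightarrow>
    collapse m k x \<in> I \<or> k \<le> x \<and> x < k + m \<and> x + 1 - k \<in> J"
proof -
  have block: "x \<in> (\<lambda>j. j + k - 1) ` B \<longleftrightarrow> k \<le> x \<and> x < k + m \<and> x + 1 - k \<in> B"
    if "B \<subseteq> {1..m}" for B
  proof
    assume "x \<in> (\<lambda>j. j + k - 1) ` B"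
    then obtain j where j: "j \<in> B" "x = j + k - 1" by blast
    then have "1 \<le> j" "j \<le> m" using that by auto
    moreover from this j(2) assms(2) have "x + 1 - k = j" by simp
    ultimately show "k \<le> x \<and> x < k + m \<and> x + 1 - k \<in> B"
      using j assms(2) by auto
  next
    assume "k \<le> x \<and> x < k + m \<and> x + 1 - k \<in> B"
    then show "x \<in> (\<lambda>j. j + k - 1) ` B"
      by (intro image_eqI[where x = "x + 1 - k"]) auto
  qed
  have tail: "x \<in> (\<lambda>i. i + m - 1) ` {i \<in> I. i > k} \<longleftrightarrow> k + m \<le> x \<and> x + 1 - m \<in> I"
  proof
    assume "x \<in> (\<lambda>i. i + m - 1) ` {i \<in> I. i > k}"
    then obtain i where i: "i \<in> I" "k < i" "x = i + m - 1" by blast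
    then have "x + 1 - m = i" "k + m \<le> x" using assms(3) by simp_all
    with i show "k + m \<le> x \<and> x + 1 - m \<in> I" by simp
  next
    assume "k + m \<le> x \<and> x + 1 - m \<in> I"
    then show "x \<in> (\<lambda>i. i + m - 1) ` {i \<in> I. i > k}"
      using assms(3) by (intro image_eqI[where x = "x + 1 - m"]) auto
  qed
  have place: "x + 1 - k \<in> {1..m}" if "k \<le> x" "x < k + m"
    using that by auto
  have "x \<in> set_comp m k I J \<longleftrightarrow> x < k \<and> x \<in> I
      \<or> k \<le> x \<and> x < k + m \<and> x + 1 - k \<in> (if k \<in> I then {1..m} else J)
      \<or> k + m \<le> x \<and> x + 1 - m \<in> I"
    unfolding set_comp_def Un_iff using block[of "if k \<in> I then {1..m} else J"] tail assms(1) by auto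
  also have "\<dots> \<longleftrightarrow> collapse m k x \<in> I \<or> k \<le> x \<and> x < k + m \<and> x + 1 - k \<in> J"
    using place by (cases "k \<in> I") (auto simp: collapse_def)
  finally show ?thesis .
qed

lemma collapse_mem_iff:
  assumes "k \<in> {1..n}" "m \<ge> 1"
  shows "collapse m k x \<in> {1..n} \<longleftrightarrow> x \<in> {1..n + m - 1}"
  using assms by (auto simp: collapse_def)

lemma set_comp_subset:
  assumes "I \<subseteq> {1..n}" "J \<subseteq> {1..m}" "k \<in> {1..n}" "m \<ge> 1"
  shows "set_comp m k I J \<subseteq> {1..n + m - 1}"
proof
  fix x assume "x \<in> set_comp m k I J"
  then have "collapse m k x \<in> I \<or> k \<le> x \<and> x < k + m"
    using assms by (auto simp: mem_set_comp)
  then show "x \<in> {1..n + m - 1}"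
    using assms collapse_mem_iff[of k n m x] by auto
qed

lemma set_comp_mono:
  assumes "I \<subseteq> I'" "J \<subseteq> J'" "J' \<subseteq> {1..m}" "k \<ge> 1" "m \<ge> 1"
  shows "set_comp m k I J \<subseteq> set_comp m k I' J'"
proof -
  have "J \<subseteq> {1..m}" using assms by blast
  with assms show ?thesis by (auto simp: mem_set_comp)
qed

lemma set_comp_sequential:
  assumes "J \<subseteq> {1..m}" "H \<subseteq> {1..n}" "i \<ge> 1" "j \<in> {1..m}" "n \<ge> 1"
  shows "set_comp n (i + j - 1) (set_comp m i I J) H = set_comp (m + n - 1) i I (set_comp n j J H)"
proof (rule set_eqI)
  fix x
  let ?y = "collapse n (i + j - 1) x"
  have sub: "set_comp n j J H \<subseteq> {1..m + n - 1}"
    using assms by (intro set_comp_subset) auto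
  have pos: "i + j - 1 \<ge> 1" "m \<ge> 1" "m + n - 1 \<ge> 1" "j \<ge> 1"
    using assms by auto
  \<comment> \<open>Collapsing first the inner and then the outer block collapses the composite block.\<close>
  have outer: "collapse m i ?y = collapse (m + n - 1) i x"
    using assms by (auto simp: collapse_def)
  have middle: "i \<le> ?y \<and> ?y < i + m \<longleftrightarrow> i \<le> x \<and> x < i + (m + n - 1)"
    using assms by (auto simp: collapse_def)
  have middle_place: "?y + 1 - i = collapse n j (x + 1 - i)" if "i \<le> x"
    using assms that by (auto simp: collapse_def)
  have inner: "i + j - 1 \<le> x \<and> x < i + j - 1 + n \<longleftrightarrow>
      (i \<le> x \<and> x < i + (m + n - 1)) \<and> j \<le> x + 1 - i \<and> x + 1 - i < j + n"
    using assms by auto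
  have inner_place: "x + 1 - (i + j - 1) = x + 1 - i + 1 - j" if "i \<le> x"
    using assms that by auto
  have "x \<in> set_comp n (i + j - 1) (set_comp m i I J) H \<longleftrightarrow>
      (collapse m i ?y \<in> I \<or> (i \<le> ?y \<and> ?y < i + m) \<and> ?y + 1 - i \<in> J)
      \<or> (i + j - 1 \<le> x \<and> x < i + j - 1 + n) \<and> x + 1 - (i + j - 1) \<in> H"
    using assms pos by (simp add: mem_set_comp del: One_nat_def)
  also have "\<dots> \<longleftrightarrow> collapse (m + n - 1) i x \<in> I \<or> (i \<le> x \<and> x < i + (m + n - 1)) \<and>
      (collapse n j (x + 1 - i) \<in> J
        \<or> (j \<le> x + 1 - i \<and> x + 1 - i < j + n) \<and> x + 1 - i + 1 - j \<in> H)"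
    unfolding outer middle inner using middle_place inner_place by auto
  also have "\<dots> \<longleftrightarrow> x \<in> set_comp (m + n - 1) i I (set_comp n j J H)"
    using assms sub pos by (simp add: mem_set_comp del: One_nat_def)
  finally show "x \<in> set_comp n (i + j - 1) (set_comp m i I J) H \<longleftrightarrow>
      x \<in> set_comp (m + n - 1) i I (set_comp n j J H)" .
qed

lemma set_comp_parallel:
  assumes "J \<subseteq> {1..m}" "H \<subseteq> {1..n}" "i \<ge> 1" "i < j" "m \<ge> 1" "n \<ge> 1"
  shows "set_comp n (j + m - 1) (set_comp m i I J) H = set_comp m i (set_comp n j I H) J"
proof (rule set_eqI)
  fix x
  let ?y = "collapse n (j + m - 1) x" and ?z = "collapse m i x"
  \<comment> \<open>The two blocks are disjoint, so they can be collapsed in either order, and collapsing one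
      changes neither membership nor places in the other.\<close>
  have commute: "collapse m i ?y = collapse n j ?z"
    using assms by (auto simp: collapse_def)
  have left: "i \<le> ?y \<and> ?y < i + m \<and> ?y + 1 - i \<in> J \<longleftrightarrow> i \<le> x \<and> x < i + m \<and> x + 1 - i \<in> J"
    using assms by (auto simp: collapse_def)
  have right: "j + m - 1 \<le> x \<and> x < j + m - 1 + n \<longleftrightarrow> j \<le> ?z \<and> ?z < j + n"
    using assms by (auto simp: collapse_def)
  have right_place: "x + 1 - (j + m - 1) = ?z + 1 - j" if "j + m - 1 \<le> x"
    using assms that by (auto simp: collapse_def)
  have "x \<in> set_comp n (j + m - 1) (set_comp m i I J) H \<longleftrightarrow>
      (collapse m i ?y \<in> I \<or> i \<le> ?y \<and> ?y < i + m \<and> ?y + 1 - i \<in> J)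
      \<or> (j + m - 1 \<le> x \<and> x < j + m - 1 + n) \<and> x + 1 - (j + m - 1) \<in> H"
    using assms by (simp add: mem_set_comp)
  also have "\<dots> \<longleftrightarrow> (collapse n j ?z \<in> I \<or> (j \<le> ?z \<and> ?z < j + n) \<and> ?z + 1 - j \<in> H)
      \<or> i \<le> x \<and> x < i + m \<and> x + 1 - i \<in> J"
    unfolding commute left using right right_place by auto
  also have "\<dots> \<longleftrightarrow> x \<in> set_comp m i (set_comp n j I H) J"
    using assms by (simp add: mem_set_comp)
  finally show "x \<in> set_comp n (j + m - 1) (set_comp m i I J) H \<longleftrightarrow>
      x \<in> set_comp m i (set_comp n j I H) J" .
qed

text \<open>
  The position in the composite of an input \<open>i \<noteq> k\<close> of the first factor.
\<close>

definition spread :: "nat \<Rightarrow> nat \<Rightarrow> nat \<Rightarrow> nat" where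
  "spread m k i = (if i < k then i else i + m - 1)"

lemma set_comp_eq_images:
  "set_comp m k I J =
    spread m k ` (I - {k}) \<union> (\<lambda>j. j + k - 1) ` (if k \<in> I then {1..m} else J)"
proof -
  have "I - {k} = {i \<in> I. i < k} \<union> {i \<in> I. i > k}" by auto
  moreover have "spread m k ` {i \<in> I. i < k} = {i \<in> I. i < k}"
    by (auto simp: spread_def image_iff)
  moreover have "spread m k ` {i \<in> I. i > k} = (\<lambda>i. i + m - 1) ` {i \<in> I. i > k}"
    by (rule image_cong) (auto simp: spread_def)
  ultimately show ?thesis
    unfolding set_comp_def by (simp add: image_Un Un_ac)
qed

lemma perm_pcomp_spread:
  assumes "m \<ge> 1" "i \<noteq> k" "\<sigma> i \<noteq> \<sigma> k"
  shows "perm_pcomp m k \<sigma> \<tau> (spread m k i) = spread m (\<sigma> k) (\<sigma> i)"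
  using assms by (auto simp: perm_pcomp_def spread_def Let_def)

lemma perm_pcomp_block:
  assumes "k \<ge> 1" "j \<in> {1..m}"
  shows "perm_pcomp m k \<sigma> \<tau> (j + k - 1) = \<tau> j + \<sigma> k - 1"
  using assms by (auto simp: perm_pcomp_def)

text \<open>
  The permutation \<open>\<sigma> \<circ>\<^sub>k \<tau>\<close> acts as \<open>\<sigma>\<close> on the part that comes from \<open>I\<close> and as \<open>\<tau>\<close> on the block, and
  \<open>\<tau>\<close> maps a full block to a full block.
\<close>

lemma set_comp_equivariant:
  assumes "J \<subseteq> {1..m}" "k \<ge> 1" "m \<ge> 1" "inj \<sigma>" "\<tau> permutes {1..m}"
  shows "set_comp m (\<sigma> k) (\<sigma> ` I) (\<tau> ` J) = perm_pcomp m k \<sigma> \<tau> ` set_comp m k I J"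
proof -
  let ?\<pi> = "perm_pcomp m k \<sigma> \<tau>" and ?B = "if k \<in> I then {1..m} else J"
  have "?\<pi> ` spread m k ` (I - {k}) = spread m (\<sigma> k) ` \<sigma> ` (I - {k})"
    unfolding image_image
  proof (rule image_cong)
    fix i assume "i \<in> I - {k}"
    then show "?\<pi> (spread m k i) = spread m (\<sigma> k) (\<sigma> i)"
      using assms by (intro perm_pcomp_spread) (auto simp: inj_eq)
  qed simp
  moreover have "\<sigma> ` (I - {k}) = \<sigma> ` I - {\<sigma> k}"
    using assms(4) by (simp add: image_set_diff)
  moreover have "?\<pi> ` (\<lambda>j. j + k - 1) ` ?B = (\<lambda>j. j + \<sigma> k - 1) ` \<tau> ` ?B"
    unfolding image_image
  proof (rule image_cong)
    fix j assume "j \<in> ?B"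
    then show "?\<pi> (j + k - 1) = \<tau> j + \<sigma> k - 1"
      using assms by (intro perm_pcomp_block) (auto split: if_splits)
  qed simp
  moreover have "\<tau> ` ?B = (if \<sigma> k \<in> \<sigma> ` I then {1..m} else \<tau> ` J)"
    using permutes_image[OF assms(5)] assms(4) by (simp add: inj_image_mem_iff)
  ultimately show ?thesis
    unfolding set_comp_eq_images image_Un by simp
qed

section \<open>The composition operad\<close>

lemma scpx_pos: "K \<in> scpx n \<Longrightarrow> n \<ge> 1"
  by (auto simp: scpx_def split: if_splits)

lemma scpx_subset: "K \<in> scpx n \<Longrightarrow> I \<in> K \<Longrightarrow> I \<subseteq> {1..n}"
  by (auto simp: scpx_def split: if_splits)

lemma scpx_down: "K \<in> scpx n \<Longrightarrow> I \<in> K \<Longrightarrow> J \<subseteq> I \<Longrightarrow> J \<in> K"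
  by (auto simp: scpx_def split: if_splits)

text \<open>
  The next two lemmas rewrite an iterated composite as the down-closure of the iterated composites of
  members, so that the associativity laws for sets apply.
\<close>

lemma cpx_comp_cpx_comp_left:
  assumes "\<And>H. H \<in> N \<Longrightarrow> H \<subseteq> {1..n}" "p \<ge> 1" "n \<ge> 1"
  shows "cpx_comp n p (cpx_comp m i K M) N =
    {A. \<exists>I\<in>K. \<exists>J\<in>M. \<exists>H\<in>N. A \<subseteq> set_comp n p (set_comp m i I J) H}"
proof -
  have mono: "set_comp n p B H \<subseteq> set_comp n p (set_comp m i I J) H"
    if "B \<subseteq> set_comp m i I J" "H \<in> N" for B I J H
    using that assms by (intro set_comp_mono) auto
  show ?thesis
  proof (intro subset_antisym subsetI CollectI)
    fix A assume "A \<in> cpx_comp n p (cpx_comp m i K M) N"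
    then obtain B I J H where
      "I \<in> K" "J \<in> M" "H \<in> N" "B \<subseteq> set_comp m i I J" "A \<subseteq> set_comp n p B H"
      by (auto simp: cpx_comp_def)
    with mono show "\<exists>I\<in>K. \<exists>J\<in>M. \<exists>H\<in>N. A \<subseteq> set_comp n p (set_comp m i I J) H"
      by (meson subset_trans)
  qed (auto simp: cpx_comp_def)
qed

lemma cpx_comp_cpx_comp_right:
  assumes "\<And>J H. J \<in> M \<Longrightarrow> H \<in> N \<Longrightarrow> set_comp n j J H \<subseteq> {1..q}" "p \<ge> 1" "q \<ge> 1"
  shows "cpx_comp q p K (cpx_comp n j M N) =
    {A. \<exists>I\<in>K. \<exists>J\<in>M. \<exists>H\<in>N. A \<subseteq> set_comp q p I (set_comp n j J H)}"
proof -
  have mono: "set_comp q p I B \<subseteq> set_comp q p I (set_comp n j J H)"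
    if "B \<subseteq> set_comp n j J H" "J \<in> M" "H \<in> N" for B I J H
    using that assms by (intro set_comp_mono) auto
  show ?thesis
  proof (intro subset_antisym subsetI CollectI)
    fix A assume "A \<in> cpx_comp q p K (cpx_comp n j M N)"
    then obtain I B J H where
      "I \<in> K" "J \<in> M" "H \<in> N" "B \<subseteq> set_comp n j J H" "A \<subseteq> set_comp q p I B"
      by (auto simp: cpx_comp_def)
    with mono show "\<exists>I\<in>K. \<exists>J\<in>M. \<exists>H\<in>N. A \<subseteq> set_comp q p I (set_comp n j J H)"
      by (meson subset_trans)
  qed (auto simp: cpx_comp_def)
qed

lemma cpx_comp_in_scpx:
  assumes "K \<in> scpx n" "L \<in> scpx m" "k \<in> {1..n}"
  shows "cpx_comp m k K L \<in> scpx (n + m - 1)"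
proof -
  have "set_comp m k I J \<subseteq> {1..n + m - 1}" if "I \<in> K" "J \<in> L" for I J
    using that assms scpx_subset scpx_pos by (intro set_comp_subset) auto
  then have "cpx_comp m k K L \<subseteq> Pow {1..n + m - 1}"
    unfolding cpx_comp_def by blast
  moreover have "\<forall>A\<in>cpx_comp m k K L. \<forall>B. B \<subseteq> A \<longrightarrow> B \<in> cpx_comp m k K L"
    unfolding cpx_comp_def by blast
  moreover have "n + m - 1 \<ge> 1"
    using scpx_pos[OF assms(1)] scpx_pos[OF assms(2)] by simp
  ultimately show ?thesis
    unfolding scpx_def by simp
qed

lemma relabel_in_scpx:
  assumes "\<sigma> permutes {1..n}" "K \<in> scpx n"
  shows "relabel \<sigma> K \<in> scpx n"
proof -
  have "relabel \<sigma> K \<subseteq> Pow {1..n}"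
    using scpx_subset[OF assms(2)] permutes_image[OF assms(1)] unfolding relabel_def by blast
  moreover have "J \<in> relabel \<sigma> K" if "A \<in> relabel \<sigma> K" "J \<subseteq> A" for A J
    using that scpx_down[OF assms(2)] by (auto simp: relabel_def subset_image_iff)
  ultimately show ?thesis
    using scpx_pos[OF assms(2)] unfolding scpx_def by auto
qed

lemma cpx_comp_relabel:
  assumes "L \<in> scpx m" "k \<ge> 1" "inj \<sigma>" "\<tau> permutes {1..m}"
  shows "cpx_comp m (\<sigma> k) (relabel \<sigma> K) (relabel \<tau> L) =
    relabel (perm_pcomp m k \<sigma> \<tau>) (cpx_comp m k K L)"
proof -
  let ?\<pi> = "perm_pcomp m k \<sigma> \<tau>"
  have "set_comp m (\<sigma> k) (\<sigma> ` I) (\<tau> ` J) = ?\<pi> ` set_comp m k I J" if "J \<in> L" for I J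
    using that assms scpx_subset scpx_pos by (intro set_comp_equivariant) auto
  then have "cpx_comp m (\<sigma> k) (relabel \<sigma> K) (relabel \<tau> L) =
      {A. \<exists>I\<in>K. \<exists>J\<in>L. A \<subseteq> ?\<pi> ` set_comp m k I J}"
    unfolding cpx_comp_def relabel_def by simp
  also have "\<dots> = relabel ?\<pi> (cpx_comp m k K L)"
    unfolding cpx_comp_def relabel_def subset_image_iff by blast
  finally show ?thesis .
qed

lemma cpx_comp_left_unit:
  assumes "L \<in> scpx m"
  shows "cpx_comp m 1 {{}} L = L"
proof -
  have "set_comp m 1 {} J = J" for J
    by (simp add: set_comp_def)
  then show ?thesis
    using scpx_down[OF assms] by (auto simp: cpx_comp_def)
qed

lemma cpx_comp_right_unit:
  assumes "K \<in> scpx n"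
  shows "cpx_comp 1 k K {{}} = K"
proof -
  have "set_comp 1 k I {} = I" for I
    by (auto simp: set_comp_def) (metis linorder_neqE_nat)
  then show ?thesis
    using scpx_down[OF assms] by (auto simp: cpx_comp_def)
qed

lemma cpx_comp_sequential:
  assumes "K \<in> scpx l" "M \<in> scpx m" "N \<in> scpx n" "i \<in> {1..l}" "j \<in> {1..m}"
  shows "cpx_comp n (i + j - 1) (cpx_comp m i K M) N =
    cpx_comp (m + n - 1) i K (cpx_comp n j M N)"
proof -
  note sub = scpx_subset[OF assms(2)] scpx_subset[OF assms(3)]
  note pos = scpx_pos[OF assms(2)] scpx_pos[OF assms(3)]
  have "cpx_comp n (i + j - 1) (cpx_comp m i K M) N =
      {A. \<exists>I\<in>K. \<exists>J\<in>M. \<exists>H\<in>N. A \<subseteq> set_comp n (i + j - 1) (set_comp m i I J) H}"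
    using assms sub pos by (intro cpx_comp_cpx_comp_left) auto
  also have "\<dots> = {A. \<exists>I\<in>K. \<exists>J\<in>M. \<exists>H\<in>N. A \<subseteq> set_comp (m + n - 1) i I (set_comp n j J H)}"
  proof -
    have "set_comp n (i + j - 1) (set_comp m i I J) H =
        set_comp (m + n - 1) i I (set_comp n j J H)" if "J \<in> M" "H \<in> N" for I J H
      using that assms sub pos by (intro set_comp_sequential) auto
    then show ?thesis by (simp cong: bex_cong)
  qed
  also have "\<dots> = cpx_comp (m + n - 1) i K (cpx_comp n j M N)"
  proof (rule cpx_comp_cpx_comp_right[symmetric])
    show "set_comp n j J H \<subseteq> {1..m + n - 1}" if "J \<in> M" "H \<in> N" for J H
      using that assms sub pos by (intro set_comp_subset) auto
  qed (use assms pos in auto)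
  finally show ?thesis .
qed

lemma cpx_comp_parallel:
  assumes "M \<in> scpx m" "N \<in> scpx n" "i \<ge> 1" "i < j"
  shows "cpx_comp n (j + m - 1) (cpx_comp m i K M) N = cpx_comp m i (cpx_comp n j K N) M"
proof -
  note sub = scpx_subset[OF assms(1)] scpx_subset[OF assms(2)]
  note pos = scpx_pos[OF assms(1)] scpx_pos[OF assms(2)]
  have "cpx_comp n (j + m - 1) (cpx_comp m i K M) N =
      {A. \<exists>I\<in>K. \<exists>J\<in>M. \<exists>H\<in>N. A \<subseteq> set_comp n (j + m - 1) (set_comp m i I J) H}"
    using assms sub pos by (intro cpx_comp_cpx_comp_left) auto
  also have "\<dots> = {A. \<exists>I\<in>K. \<exists>H\<in>N. \<exists>J\<in>M. A \<subseteq> set_comp m i (set_comp n j I H) J}"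
  proof -
    have "set_comp n (j + m - 1) (set_comp m i I J) H = set_comp m i (set_comp n j I H) J"
      if "J \<in> M" "H \<in> N" for I J H
      using that assms sub pos by (intro set_comp_parallel) auto
    then show ?thesis by (simp cong: bex_cong) blast
  qed
  also have "\<dots> = cpx_comp m i (cpx_comp n j K N) M"
    using assms sub pos by (intro cpx_comp_cpx_comp_left[symmetric]) auto
  finally show ?thesis .
qed

lemma scpx_operad_sel [simp]:
  "ops scpx_operad = scpx" "act scpx_operad n = relabel" "pcomp scpx_operad n = cpx_comp"
  "opunit scpx_operad = {{}}"
  by (simp_all add: scpx_operad_def)

lemma operad_scpx: "operad scpx_operad"
proof
  fix l m n i j :: nat and \<kappa> \<mu> \<nu>
  assume "\<kappa> \<in> ops scpx_operad l" "\<mu> \<in> ops scpx_operad m" "\<nu> \<in> ops scpx_operad n"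
    "i \<in> {1..l}" "j \<in> {1..m}"
  then show "pcomp scpx_operad (l + m - 1) n (i + j - 1) (pcomp scpx_operad l m i \<kappa> \<mu>) \<nu> =
      pcomp scpx_operad l (m + n - 1) i \<kappa> (pcomp scpx_operad m n j \<mu> \<nu>)"
    unfolding scpx_operad_sel by (rule cpx_comp_sequential)
next
  fix l m n i j :: nat and \<kappa> \<mu> \<nu>
  assume "\<kappa> \<in> ops scpx_operad l" "\<mu> \<in> ops scpx_operad m" "\<nu> \<in> ops scpx_operad n"
    "i \<in> {1..l}" "j \<in> {1..l}" "i < j"
  then show "pcomp scpx_operad (l + m - 1) n (j + m - 1) (pcomp scpx_operad l m i \<kappa> \<mu>) \<nu> =
      pcomp scpx_operad (l + n - 1) m i (pcomp scpx_operad l n j \<kappa> \<nu>) \<mu>"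
    unfolding scpx_operad_sel by (intro cpx_comp_parallel) auto
next
  fix n m k :: nat and \<mu> \<nu> \<sigma> \<tau>
  assume "\<mu> \<in> ops scpx_operad n" "\<nu> \<in> ops scpx_operad m" "k \<in> {1..n}"
    "\<sigma> permutes {1..n}" "\<tau> permutes {1..m}"
  then show "pcomp scpx_operad n m (\<sigma> k) (act scpx_operad n \<sigma> \<mu>) (act scpx_operad m \<tau> \<nu>) =
      act scpx_operad (n + m - 1) (perm_pcomp m k \<sigma> \<tau>) (pcomp scpx_operad n m k \<mu> \<nu>)"
    unfolding scpx_operad_sel by (intro cpx_comp_relabel) (auto intro: permutes_inj)
next
  show "opunit scpx_operad \<in> ops scpx_operad 1"
    by (simp add: scpx_def)
next
  fix n and \<sigma> \<tau> :: "nat \<Rightarrow> nat" and \<mu>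
  show "act scpx_operad n (\<sigma> \<circ> \<tau>) \<mu> = act scpx_operad n \<sigma> (act scpx_operad n \<tau> \<mu>)"
    by (simp add: relabel_def image_comp comp_def)
next
  show "act scpx_operad n id \<mu> = \<mu>" for n \<mu>
    by (simp add: relabel_def)
qed (simp_all add: relabel_in_scpx cpx_comp_in_scpx cpx_comp_left_unit cpx_comp_right_unit
    del: One_nat_def)

text \<open>Only closure of a collection remains to be checked in order to obtain a suboperad.\<close>

lemma nonunital_suboperad_scpxI:
  assumes "\<And>n. Q n \<subseteq> scpx n"
    and "\<And>n \<sigma> K. \<sigma> permutes {1..n} \<Longrightarrow> K \<in> Q n \<Longrightarrow> relabel \<sigma> K \<in> Q n"
    and "\<And>n m k K L. K \<in> Q n \<Longrightarrow> L \<in> Q m \<Longrightarrow> k \<in> {1..n} \<Longrightarrow> cpx_comp m k K L \<in> Q (n + m - 1)"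
  shows "nonunital_suboperad Q scpx_operad"
proof -
  interpret operad scpx_operad by (rule operad_scpx)
  show ?thesis
    by unfold_locales (use assms in simp_all)
qed

lemma suboperad_scpxI:
  assumes "nonunital_suboperad Q scpx_operad" "{{}} \<in> Q 1"
  shows "suboperad Q scpx_operad"
proof -
  interpret operad scpx_operad by (rule operad_scpx)
  interpret nonunital_suboperad Q scpx_operad by fact
  show ?thesis
    by unfold_locales (use assms(2) in simp)
qed

lemma suboperad_scpx_ne: "suboperad scpx_ne scpx_operad"
proof (intro suboperad_scpxI nonunital_suboperad_scpxI)
  show "relabel \<sigma> K \<in> scpx_ne n" if "\<sigma> permutes {1..n}" "K \<in> scpx_ne n" for n \<sigma> K
    using that relabel_in_scpx by (auto simp: scpx_ne_def relabel_def)
  show "cpx_comp m k K L \<in> scpx_ne (n + m - 1)"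
    if "K \<in> scpx_ne n" "L \<in> scpx_ne m" "k \<in> {1..n}" for n m k K L
    using that cpx_comp_in_scpx[of K n L m k] by (auto simp: scpx_ne_def cpx_comp_def)
qed (auto simp: scpx_ne_def scpx_def)

section \<open>The three collections\<close>

lemma suboperad_trivial: "suboperad trivial_coll scpx_operad"
proof (intro suboperad_scpxI nonunital_suboperad_scpxI)
  show "cpx_comp m k K L \<in> trivial_coll (n + m - 1)"
    if "K \<in> trivial_coll n" "L \<in> trivial_coll m" "k \<in> {1..n}" for n m k K L
    using that by (auto simp: trivial_coll_def cpx_comp_def set_comp_def split: if_splits)
qed (auto simp: trivial_coll_def scpx_def relabel_def split: if_splits)

text \<open>The top face composed with any face is the top face, and a nonempty factor supplies one.\<close>

lemma cpx_comp_full_simplex: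
  assumes "n \<ge> 1" "m \<ge> 1" "k \<in> {1..n}"
  shows "cpx_comp m k (full_simplex n) (full_simplex m) = full_simplex (n + m - 1)"
proof -
  have "{1..n + m - 1} \<subseteq> set_comp m k {1..n} {}"
  proof
    fix x assume "x \<in> {1..n + m - 1}"
    then have "collapse m k x \<in> {1..n}"
      using collapse_mem_iff assms by blast
    then show "x \<in> set_comp m k {1..n} {}"
      using assms by (subst mem_set_comp) auto
  qed
  moreover have "set_comp m k I J \<subseteq> {1..n + m - 1}" if "I \<subseteq> {1..n}" "J \<subseteq> {1..m}" for I J
    using that assms by (intro set_comp_subset) auto
  ultimately show ?thesis
    unfolding cpx_comp_def full_simplex_def by blast
qed

lemma relabel_full_simplex:
  "\<sigma> permutes {1..n} \<Longrightarrow> relabel \<sigma> (full_simplex n) = full_simplex n"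
  unfolding relabel_def full_simplex_def by (simp add: image_Pow_surj permutes_image)

lemma nonunital_suboperad_simplex: "nonunital_suboperad simplex_coll scpx_operad"
proof (rule nonunital_suboperad_scpxI)
  show "simplex_coll n \<subseteq> scpx n" for n
    by (auto simp: simplex_coll_def full_simplex_def scpx_def)
qed (auto simp: simplex_coll_def relabel_full_simplex cpx_comp_full_simplex split: if_splits)

text \<open>
  If \<open>I\<close> misses some \<open>i \<noteq> k\<close>, the composite misses the position of \<open>i\<close>; if \<open>I\<close> misses \<open>k\<close>, the block is
  a copy of \<open>J\<close> and so is not full either. Conversely, the complement of \<open>p\<close> is a composite of
  proper subsets: remove the origin of \<open>p\<close> from the first factor and, if \<open>p\<close> lies in the block, also
  the place of \<open>p\<close> in the block from the second.
\<close>

lemma cpx_comp_boundary_simplex: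
  assumes "n \<ge> 1" "m \<ge> 1" "k \<in> {1..n}"
  shows "cpx_comp m k (boundary_simplex n) (boundary_simplex m) = boundary_simplex (n + m - 1)"
proof (intro set_eqI iffI)
  fix A assume "A \<in> cpx_comp m k (boundary_simplex n) (boundary_simplex m)"
  then obtain I J where IJ: "I \<subset> {1..n}" "J \<subset> {1..m}" "A \<subseteq> set_comp m k I J"
    by (auto simp: cpx_comp_def boundary_simplex_def)
  obtain i j where ij: "i \<in> {1..n}" "i \<notin> I" "j \<in> {1..m}" "j \<notin> J"
    using IJ(1,2) by blast
  \<comment> \<open>If \<open>i = k\<close>, the whole block depends on \<open>J\<close>, and the place of \<open>j\<close> is missing.\<close>
  define p where "p = (if i = k then j + k - 1 else spread m k i)"
  have "p \<in> {1..n + m - 1}"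
    using ij assms by (auto simp: p_def spread_def)
  moreover have "p \<notin> set_comp m k I J"
  proof (cases "i = k")
    case True
    then show ?thesis
      using ij IJ(2) assms by (subst mem_set_comp) (auto simp: p_def collapse_def)
  next
    case False
    then have "p < k \<or> k + m \<le> p" "collapse m k p = i"
      using assms by (auto simp: p_def spread_def collapse_def)
    then show ?thesis
      using ij IJ(2) assms by (subst mem_set_comp) auto
  qed
  moreover have "set_comp m k I J \<subseteq> {1..n + m - 1}"
    using IJ assms by (intro set_comp_subset) auto
  ultimately show "A \<in> boundary_simplex (n + m - 1)"
    using IJ(3) by (auto simp: boundary_simplex_def)
next
  fix A assume "A \<in> boundary_simplex (n + m - 1)"
  then obtain p where p: "A \<subseteq> {1..n + m - 1}" "p \<in> {1..n + m - 1}" "p \<notin> A"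
    unfolding boundary_simplex_def by blast
  define I where "I = {1..n} - {collapse m k p}"
  define J where "J = (if k \<le> p \<and> p < k + m then {1..m} - {p + 1 - k} else {})"
  have "collapse m k p \<in> {1..n}"
    using p(2) collapse_mem_iff assms by blast
  then have I: "I \<subset> {1..n}" unfolding I_def by blast
  have J: "J \<subset> {1..m}"
  proof (cases "k \<le> p \<and> p < k + m")
    case True
    then have "p + 1 - k \<in> {1..m}" by auto
    moreover have "J = {1..m} - {p + 1 - k}" using True by (simp add: J_def)
    ultimately show ?thesis by blast
  next
    case False
    then have "J = {}" by (auto simp: J_def)
    moreover have "1 \<in> {1..m}" using assms(2) by simp
    ultimately show ?thesis by blast
  qed
  have "A \<subseteq> set_comp m k I J"
  proof
    fix x assume "x \<in> A"
    with p have x: "x \<in> {1..n + m - 1}" "x \<noteq> p" by auto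
    show "x \<in> set_comp m k I J"
    proof (cases "collapse m k x = collapse m k p")
      case False
      moreover have "collapse m k x \<in> {1..n}"
        using x(1) collapse_mem_iff assms by blast
      ultimately show ?thesis
        using J assms by (subst mem_set_comp) (auto simp: I_def)
    next
      \<comment> \<open>Distinct positions with the same collapse both lie in the block.\<close>
      case True
      then have block: "k \<le> x" "x < k + m" "k \<le> p" "p < k + m"
        using x(2) by (auto simp: collapse_def split: if_splits)
      then have "x + 1 - k \<in> J"
        using x(2) by (auto simp: J_def)
      then show ?thesis
        using J assms block by (subst mem_set_comp) auto
    qed
  qed
  then show "A \<in> cpx_comp m k (boundary_simplex n) (boundary_simplex m)"
    unfolding cpx_comp_def boundary_simplex_def using I J by blast
qed

lemma relabel_boundary_simplex:
  assumes "\<sigma> permutes {1..n}"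
  shows "relabel \<sigma> (boundary_simplex n) = boundary_simplex n"
proof -
  have "boundary_simplex n = full_simplex n - {{1..n}}"
    by (auto simp: boundary_simplex_def full_simplex_def)
  moreover have "inj ((`) \<sigma>)"
    by (rule injI) (simp add: inj_image_eq_iff[OF permutes_inj[OF assms]])
  then have "relabel \<sigma> (full_simplex n - {{1..n}}) = relabel \<sigma> (full_simplex n) - {\<sigma> ` {1..n}}"
    by (simp add: relabel_def image_set_diff)
  ultimately show ?thesis
    using assms by (simp add: relabel_full_simplex permutes_image)
qed

lemma suboperad_boundary: "suboperad boundary_coll scpx_operad"
proof (intro suboperad_scpxI nonunital_suboperad_scpxI)
  show "boundary_coll n \<subseteq> scpx n" for n
    by (auto simp: boundary_coll_def boundary_simplex_def scpx_def)
  show "{{}} \<in> boundary_coll 1"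
    by (auto simp: boundary_coll_def boundary_simplex_def)
qed (auto simp: boundary_coll_def relabel_boundary_simplex cpx_comp_boundary_simplex
    split: if_splits)

theorem proposition3p12:
  "\<forall>P \<in> {scpx_operad, scpx_ne_operad}.
     suboperad trivial_coll P \<and>
     nonunital_suboperad simplex_coll P \<and> opunit P \<notin> simplex_coll 1 \<and>
     suboperad boundary_coll P \<and>
     isomorphic (P\<lparr>ops := trivial_coll\<rparr>) Com \<and>
     nonunital_isomorphic (P\<lparr>ops := simplex_coll\<rparr>) Com \<and>
     isomorphic (P\<lparr>ops := boundary_coll\<rparr>) Com"
proof
  fix P assume P: "P \<in> {scpx_operad, scpx_ne_operad}"
  have nonempty: "{} \<notin> trivial_coll n" "{} \<notin> simplex_coll n" "{} \<notin> boundary_coll n" for n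
    by (auto simp: trivial_coll_def simplex_coll_def full_simplex_def boundary_coll_def
        boundary_simplex_def)
  note ne = suboperad_scpx_ne
  have sub_ne: "trivial_coll n \<subseteq> scpx_ne n" "simplex_coll n \<subseteq> scpx_ne n"
    "boundary_coll n \<subseteq> scpx_ne n" for n
    using nonempty[of n] suboperad.axioms(2)[OF suboperad_trivial]
      suboperad.axioms(2)[OF suboperad_boundary] nonunital_suboperad_simplex
      nonunital_suboperad.sub_ops[of _ scpx_operad n]
    unfolding scpx_ne_def scpx_operad_sel by blast+
  have T: "suboperad trivial_coll P"
    using P suboperad_trivial suboperad_restrict[OF suboperad_trivial ne sub_ne(1)]
    by (auto simp: scpx_ne_operad_def)
  have S: "nonunital_suboperad simplex_coll P"
    using P nonunital_suboperad_simplex nonunital_suboperad_restrict[OF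
        nonunital_suboperad_simplex suboperad.axioms(2)[OF ne] sub_ne(2)]
    by (auto simp: scpx_ne_operad_def)
  have B: "suboperad boundary_coll P"
    using P suboperad_boundary suboperad_restrict[OF suboperad_boundary ne sub_ne(3)]
    by (auto simp: scpx_ne_operad_def)
  have "opunit P = {{}}"
    using P by (auto simp: scpx_ne_operad_def)
  then have "opunit P \<notin> simplex_coll 1"
    by (auto simp: simplex_coll_def full_simplex_def)
  moreover have "isomorphic (P\<lparr>ops := trivial_coll\<rparr>) Com"
    by (rule isomorphic_Com[OF suboperad.operad_restrict[OF T], of "\<lambda>n. {{}}"])
      (simp add: trivial_coll_def)
  moreover have "nonunital_isomorphic (P\<lparr>ops := simplex_coll\<rparr>) Com"
    by (rule nonunital_isomorphic_Com[OF nonunital_suboperad.nonunital_operad_restrict[OF S],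
          of full_simplex])
      (simp add: simplex_coll_def)
  moreover have "isomorphic (P\<lparr>ops := boundary_coll\<rparr>) Com"
    by (rule isomorphic_Com[OF suboperad.operad_restrict[OF B], of boundary_simplex])
      (simp add: boundary_coll_def)
  ultimately show "suboperad trivial_coll P \<and>
     nonunital_suboperad simplex_coll P \<and> opunit P \<notin> simplex_coll 1 \<and>
     suboperad boundary_coll P \<and>
     isomorphic (P\<lparr>ops := trivial_coll\<rparr>) Com \<and>
     nonunital_isomorphic (P\<lparr>ops := simplex_coll\<rparr>) Com \<and>
     isomorphic (P\<lparr>ops := boundary_coll\<rparr>) Com"
    using T S B by simp
qed

end
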